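(* Let $X$ be a universal set of fuzzy points in $\mathbb{R}^2$, let $\widetilde{d}$ be the inverse-point fuzzy distance on $X$ together with its extension to a distance between a fuzzy point and a fuzzy set, and consider the two fuzzy metric spaces $(X,\widetilde{M}_d,* )$ and $(X,\widetilde{d},L,R)$ built on $\widetilde{d}$, where $\widetilde{M}_d(\widetilde{P},\widetilde{Q},t)=\frac{t}{t+\widetilde{d}(\widetilde{P},\widetilde{Q})}$ for $\widetilde{P},\widetilde{Q}\in X$, $t>0$ (all these notions are defined in the context). Let $\widetilde{A},\widetilde{B}\subset X$ be nonempty (the fuzzy focal sets, assumed compact and convex). For $\widetilde{x}\in X$ and $t>0$ let the proximity of $\widetilde{x}$ to $\widetilde{A}$ be $$\widetilde{M}_d(\widetilde{x},\widetilde{A},t):=\frac{t}{t+\widetilde{d}(\widetilde{x},\widetilde{A})},$$ and similarly for $\widetilde{B}$. Let the fuzzy equidistant set determined by $\widetilde{A}$ and $\widetilde{B}$ in $(X,\widetilde{M}_d,* )$ be, with $t>0$, $$\widetilde{E}_{\widetilde{M}}(\widetilde{A},\widetilde{B})=\bigl\{\widetilde{x}\in X:\ \widetilde{M}_d(\widetilde{x},\widetilde{A},t)=\widetilde{M}_d(\widetilde{x},\widetilde{B},t)\bigr\},$$ and the one determined by $\widetilde{A}$ and $\widetilde{B}$ in $(X,\widetilde{d},L,R)$ be $$\widetilde{E}_{\widetilde{d}}(\widetilde{A},\widetilde{B})=\bigl\{\widetilde{x}\in X:\ \widetilde{d}(\widetilde{x},\widetilde{A})=\widetilde{d}(\widetilde{x},\widetilde{B})\bigr\}.$$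 Then the fuzzy equidistant set is invariant under the choice between the two fuzzy metric spaces: $$\widetilde{E}_{\widetilde{M}}(\widetilde{A},\widetilde{B})=\widetilde{E}_{\widetilde{d}}(\widetilde{A},\widetilde{B}).$$
   Context: A fuzzy set $\widetilde{A}$ is given by a membership function $\mu(\cdot|\widetilde{A})$ with values in $[0,1]$. Its $\alpha$-cut $\widetilde{A}^{\alpha}$ is $\{\mu\ge\alpha\}$ for $0<\alpha\le1$, and $\widetilde{A}^0$ (the support) is the closure of $\{\mu>0\}$; $\widetilde{A}^1$ is the core. A fuzzy number is a fuzzy set of $\mathbb{R}$ whose membership function is upper semicontinuous, vanishes outside some interval $[a,d]$, and for some $a\le b\le c\le d$ is increasing on $[a,b]$, equal to $1$ on $[b,c]$ and decreasing on $[c,d]$. A fuzzy number along a line in $\mathbb{R}^2$ is the same notion with that line, identified with $\mathbb{R}$ by a rigid motion, in place of the real line. A fuzzy point $\widetilde{P}(a,b)$, $(a,b)\in\mathbb{R}^2$, is a fuzzy set in $\mathbb{R}^2$ whose membership function is upper semicontinuous, equals $1$ only at $(a,b)$, and all of whose $\alpha$-cuts, $\alpha\in[0,1]$, are convex and compact. Inverse points: points $u$, $v$ of the supports of fuzzy points $\widetilde{P}(a,b)$, $\widetilde{P}(c,d)$ respectively are inverse points if they have equal membership, $\mu(u|\widetilde{P}(a,b))=\mu(v|\widetilde{P}(c,d))$, they lie on different sides of the line joining $(a,b)$ and $(c,d)$, and the line joining $u$ to $(a,b)$ is parallel to the line joining $v$ to $(c,d)$. Fuzzy distance between fuzzy points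 $\widetilde{A},\widetilde{B}$: the fuzzy set $\widetilde{d}(\widetilde{A},\widetilde{B})$ in which a value $\delta$ has membership $$\sup\{\alpha:\ \delta=d(u,v),\ u\in\widetilde{A}^0,\ v\in\widetilde{B}^0 \text{ inverse points},\ \mu(u|\widetilde{A})=\mu(v|\widetilde{B})=\alpha\},$$ $d$ being Euclidean distance. One writes $\widetilde{d}(\widetilde{A},\widetilde{B})=\bigcup_{\alpha=0}^{1}\widetilde{d}^{\alpha}(\widetilde{A}^{\alpha},\widetilde{B}^{\alpha})$, where $\widetilde{d}^{\alpha}$ is its $\alpha$-level. Fuzzy distance between a fuzzy point $\widetilde{P}$ and a fuzzy set $\widetilde{A}$: $\widetilde{d}(\widetilde{P},\widetilde{A})=\widetilde{d}(\widetilde{P}_A,\widetilde{a})$, where $\widetilde{P}_A$ and $\widetilde{a}$ are the fuzzy numbers of $\widetilde{P}$ and $\widetilde{A}$ respectively along the line joining the core of $\widetilde{P}$ to the point of the core of $\widetilde{A}$ that realises the distance between the cores. Its $\alpha$-level is written $\widetilde{d}^{\alpha}(\widetilde{P}^{\alpha},\widetilde{A}^{\alpha})$. For $t>0$, $\frac{t}{t+\widetilde{d}}$ is a fuzzy set, read level by level as $\frac{t}{t+\widetilde{d}^{\alpha}}$, $\alpha\in[0,1]$; it expresses the fuzzy degree of closeness at $t$. First type of fuzzy metric space: $(X,\widetilde{M}_d,* )$ where $X$ is the universal set, whose elements are fuzzy points, $*$ is a continuous $t$-norm (a continuous, commutative, associative operation on $[0,1]$ with unit $1$, non-decreasing in each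 argument), and $\widetilde{M}_d$ is a fuzzy set on $X^2\times(0,\infty)$ such that for all fuzzy points $\widetilde{A},\widetilde{B},\widetilde{C}\in X$ and $t,s>0$: (1) $\widetilde{M}_d(\widetilde{A},\widetilde{B},t)\succ0$; (2) $\widetilde{M}_d(\widetilde{A},\widetilde{B},t)\cong1$ iff $\widetilde{A}\cong\widetilde{B}$; (3) $\widetilde{M}_d(\widetilde{A},\widetilde{B},t)\cong\widetilde{M}_d(\widetilde{B},\widetilde{A},t)$; (4) $\widetilde{M}_d(\widetilde{A},\widetilde{B},t)*\widetilde{M}_d(\widetilde{B},\widetilde{C},s)\preceq\widetilde{M}_d(\widetilde{A},\widetilde{C},t+s)$; (5) $\widetilde{M}_d(\widetilde{A},\widetilde{B},\cdot):(0,\infty)\to[0,1]$ is continuous. Here $\cong$ means "almost equals" in the fuzzy sense, $\preceq$ means "fuzzily less or equal", and $\succ$ is the corresponding fuzzy strict inequality. Second type of fuzzy metric space (Kaleva–Seikkala): $(X,\widetilde{d},L,R)$ where $\widetilde{d}$ maps $X\times X$ into the non-negative fuzzy numbers, with $\alpha$-cuts $[\lambda_\alpha(x,y),\rho_\alpha(x,y)]$ for $0<\alpha\le1$; $L,R:[0,1]^2\to[0,1]$ are symmetric, non-decreasing in both arguments, with $L(0,0)=0$ and $R(1,1)=1$; and for all $x,y,z\in X$: (1) $\widetilde{d}(x,y)=\overline{0}$ (the crisp number $0$) iff $x=y$; (2) $\widetilde{d}(x,y)=\widetilde{d}(y,x)$; (3a) $\widetilde{d}(x,y)(s+t)\le R(\widetilde{d}(x,z)(s),\widetilde{d}(z,y)(t))$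 whenever $s\le\lambda_1(x,z)$, $t\le\lambda_1(z,y)$, $s+t\le\lambda_1(x,y)$; (3b) $\widetilde{d}(x,y)(s+t)\ge L(\widetilde{d}(x,z)(s),\widetilde{d}(z,y)(t))$ whenever $s\ge\lambda_1(x,z)$, $t\ge\lambda_1(z,y)$, $s+t\ge\lambda_1(x,y)$. Here $\widetilde{d}(x,y)(s)$ denotes the membership of $s$ in the fuzzy number $\widetilde{d}(x,y)$. *)

theory Defs
  imports "HOL-Analysis.Analysis"
begin

section \<open>Fuzzy sets, fuzzy numbers, fuzzy points\<close>

text \<open>A fuzzy set is represented by its membership function.\<close>

type_synonym 'a fuzzy = "'a \<Rightarrow> real"

definition fuzzy_set :: "'a fuzzy \<Rightarrow> bool" where
  "fuzzy_set \<mu> \<longleftrightarrow> (\<forall>x. 0 \<le> \<mu> x \<and> \<mu> x \<le> 1)"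

definition cut :: "'a::topological_space fuzzy \<Rightarrow> real \<Rightarrow> 'a set" where
  "cut \<mu> \<alpha> = (if \<alpha> = 0 then closure {x. \<mu> x > 0} else {x. \<mu> x \<ge> \<alpha>})"

definition upper_semicontinuous :: "('a::topological_space \<Rightarrow> real) \<Rightarrow> bool" where
  "upper_semicontinuous f \<longleftrightarrow> (\<forall>r. open {x. f x < r})"

definition fuzzy_number :: "real fuzzy \<Rightarrow> bool" where
  "fuzzy_number \<mu> \<longleftrightarrow> fuzzy_set \<mu> \<and> upper_semicontinuous \<mu> \<and>
     (\<exists>a b c d. a \<le> b \<and> b \<le> c \<and> c \<le> d \<and> (\<forall>x. x \<notin> {a..d} \<longrightarrow> \<mu> x = 0) \<and>
        mono_on {a..b} \<mu> \<and> (\<forall>x\<in>{b..c}. \<mu> x = 1) \<and> antimono_on {c..d} \<mu>)"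

abbreviation crisp_number :: "real \<Rightarrow> real fuzzy" where
  "crisp_number r \<equiv> indicator {r}"

definition nonneg_fuzzy_number :: "real fuzzy \<Rightarrow> bool" where
  "nonneg_fuzzy_number \<mu> \<longleftrightarrow> fuzzy_number \<mu> \<and> (\<forall>x<0. \<mu> x = 0)"

definition fuzzy_number_along :: "(real^2) set \<Rightarrow> (real^2) fuzzy \<Rightarrow> bool" where
  "fuzzy_number_along l \<mu> \<longleftrightarrow> (\<forall>z. z \<notin> l \<longrightarrow> \<mu> z = 0) \<and>
     (\<exists>p e. norm e = 1 \<and> l = range (\<lambda>s. p + s *\<^sub>R e) \<and> fuzzy_number (\<lambda>s. \<mu> (p + s *\<^sub>R e)))"

definition compact_convex_cuts :: "(real^2) fuzzy \<Rightarrow> bool" where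
  "compact_convex_cuts \<mu> \<longleftrightarrow> (\<forall>\<alpha>\<in>{0..1}. compact (cut \<mu> \<alpha>) \<and> convex (cut \<mu> \<alpha>))"

definition fuzzy_point_at :: "real^2 \<Rightarrow> (real^2) fuzzy \<Rightarrow> bool" where
  "fuzzy_point_at p P \<longleftrightarrow> fuzzy_set P \<and> upper_semicontinuous P \<and>
     (\<forall>z. P z = 1 \<longleftrightarrow> z = p) \<and> compact_convex_cuts P"

definition fuzzy_point :: "(real^2) fuzzy \<Rightarrow> bool" where
  "fuzzy_point P \<longleftrightarrow> (\<exists>p. fuzzy_point_at p P)"

definition core_point :: "(real^2) fuzzy \<Rightarrow> real^2" where
  "core_point P = (THE p. P p = 1)"

text \<open>The fuzzy set in the plane made up of a collection of fuzzy points.\<close>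

definition fuzzy_union :: "(real^2) fuzzy set \<Rightarrow> (real^2) fuzzy" where
  "fuzzy_union A z = (SUP P\<in>A. P z)"

text \<open>The fuzzy set \<open>\<Union>\<^sub>\<alpha> S \<alpha>\<close> given level by level:
  the membership of \<open>x\<close> is the supremum of the \<open>\<alpha>\<close> with \<open>x \<in> S \<alpha>\<close>.  The inserted 0 only
  fixes the value of the empty supremum, here and in \<open>inverse_distance\<close>.\<close>

definition fuzzy_of_levels :: "(real \<Rightarrow> 'a set) \<Rightarrow> 'a fuzzy" where
  "fuzzy_of_levels S x = Sup (insert 0 {\<alpha>\<in>{0..1}. x \<in> S \<alpha>})"

section \<open>Inverse points and fuzzy distances\<close>

definition opposite_sides :: "real^2 \<Rightarrow> real^2 \<Rightarrow> real^2 \<Rightarrow> real^2 \<Rightarrow> bool" where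
  "opposite_sides p q u v \<longleftrightarrow> p \<noteq> q \<and> u \<notin> affine hull {p, q} \<and> v \<notin> affine hull {p, q} \<and>
     closed_segment u v \<inter> affine hull {p, q} \<noteq> {}"

text \<open>\<open>u\<close>, \<open>v\<close> are inverse points of the fuzzy sets \<open>P\<close>, \<open>Q\<close> with reference points
  \<open>p\<close>, \<open>q\<close> of their cores.  Off the line \<open>pq\<close> the points lie strictly on different sides of it
  and the lines \<open>up\<close>, \<open>vq\<close> are parallel.  On the line \<open>pq\<close> sides and parallelism degenerate
  and the condition becomes the one for fuzzy numbers on a line: the displacements of \<open>u\<close> from
  \<open>p\<close> and of \<open>v\<close> from \<open>q\<close> are not in the same direction.  This is what pairs the cores with
  each other, and it is the only case that occurs for fuzzy numbers along a common line.  If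
  \<open>p = q\<close> the line shrinks to \<open>{p}\<close> and only \<open>u = v = p\<close> is left, so that the distance of
  a fuzzy point to itself is the crisp number 0, as the Kaleva--Seikkala axioms demand.\<close>

definition inverse_points ::
    "(real^2) fuzzy \<Rightarrow> real^2 \<Rightarrow> (real^2) fuzzy \<Rightarrow> real^2 \<Rightarrow> real^2 \<Rightarrow> real^2 \<Rightarrow> bool" where
  "inverse_points P p Q q u v \<longleftrightarrow> u \<in> cut P 0 \<and> v \<in> cut Q 0 \<and> P u = Q v \<and>
     (opposite_sides p q u v \<and> (\<exists>k. v - q = k *\<^sub>R (u - p)) \<or>
      u \<in> affine hull {p, q} \<and> v \<in> affine hull {p, q} \<and> (u - p) \<bullet> (v - q) \<le> 0)"

definition inverse_distance ::
    "(real^2) fuzzy \<Rightarrow> real^2 \<Rightarrow> (real^2) fuzzy \<Rightarrow> real^2 \<Rightarrow> real fuzzy" where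
  "inverse_distance P p Q q \<delta> =
     Sup (insert 0 {\<alpha>. \<exists>u v. \<delta> = dist u v \<and> inverse_points P p Q q u v \<and> P u = \<alpha> \<and> Q v = \<alpha>})"

definition fuzzy_dist :: "(real^2) fuzzy \<Rightarrow> (real^2) fuzzy \<Rightarrow> real fuzzy" where
  "fuzzy_dist P Q = inverse_distance P (core_point P) Q (core_point Q)"

definition restrict_to_line :: "(real^2) fuzzy \<Rightarrow> (real^2) set \<Rightarrow> (real^2) fuzzy" where
  "restrict_to_line \<mu> l z = (if z \<in> l then \<mu> z else 0)"

definition fuzzy_dist_set :: "(real^2) fuzzy \<Rightarrow> (real^2) fuzzy \<Rightarrow> real fuzzy" where
  "fuzzy_dist_set P \<mu> =
     (let p = core_point P; a = closest_point (cut \<mu> 1) p; l = affine hull {p, a}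
      in inverse_distance (restrict_to_line P l) p (restrict_to_line \<mu> l) a)"

text \<open>\<open>t / (t + d)\<close>, read level by level.\<close>

definition closeness :: "real \<Rightarrow> real fuzzy \<Rightarrow> real fuzzy" where
  "closeness t d = fuzzy_of_levels (\<lambda>\<alpha>. (\<lambda>\<delta>. t / (t + \<delta>)) ` cut d \<alpha>)"

definition fuzzy_M :: "(real^2) fuzzy \<Rightarrow> (real^2) fuzzy \<Rightarrow> real \<Rightarrow> real fuzzy" where
  "fuzzy_M P Q t = closeness t (fuzzy_dist P Q)"

definition fuzzy_M_set :: "(real^2) fuzzy \<Rightarrow> (real^2) fuzzy \<Rightarrow> real \<Rightarrow> real fuzzy" where
  "fuzzy_M_set P \<mu> t = closeness t (fuzzy_dist_set P \<mu>)"

section \<open>The two types of fuzzy metric space\<close>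

definition continuous_t_norm :: "(real \<Rightarrow> real \<Rightarrow> real) \<Rightarrow> bool" where
  "continuous_t_norm star \<longleftrightarrow>
     (\<forall>a\<in>{0..1}. \<forall>b\<in>{0..1}. star a b \<in> {0..1} \<and> star a b = star b a) \<and>
     (\<forall>a\<in>{0..1}. \<forall>b\<in>{0..1}. \<forall>c\<in>{0..1}. star (star a b) c = star a (star b c)) \<and>
     (\<forall>a\<in>{0..1}. star a 1 = a) \<and>
     (\<forall>a\<in>{0..1}. \<forall>b\<in>{0..1}. \<forall>a'\<in>{0..1}. \<forall>b'\<in>{0..1}.
        a \<le> a' \<longrightarrow> b \<le> b' \<longrightarrow> star a b \<le> star a' b') \<and>
     continuous_on ({0..1} \<times> {0..1}) (\<lambda>(a, b). star a b)"

text \<open>A t-norm acts on fuzzy degrees level by level.\<close>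

definition fuzzy_star :: "(real \<Rightarrow> real \<Rightarrow> real) \<Rightarrow> real fuzzy \<Rightarrow> real fuzzy \<Rightarrow> real fuzzy" where
  "fuzzy_star star F G = fuzzy_of_levels (\<lambda>\<alpha>. {star a b | a b. a \<in> cut F \<alpha> \<and> b \<in> cut G \<alpha>})"

text \<open>The relations ``almost equals'' on fuzzy points (\<open>eqp\<close>) and on fuzzy degrees (\<open>eqd\<close>) and
  ``fuzzily less or equal'' (\<open>le\<close>) are parameters; \<open>F\<close> is fuzzily less than \<open>G\<close> if
  \<open>le F G\<close> but not \<open>eqd F G\<close>.  The degrees of \<open>M\<close> are fuzzy subsets of \<open>[0,1]\<close>, and
  continuity in \<open>t\<close> is continuity of the end points of every level.\<close>

definition fuzzy_metric_space ::
    "((real^2) fuzzy \<Rightarrow> (real^2) fuzzy \<Rightarrow> bool) \<Rightarrow> (real fuzzy \<Rightarrow> real fuzzy \<Rightarrow> bool) \<Rightarrow>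
     (real fuzzy \<Rightarrow> real fuzzy \<Rightarrow> bool) \<Rightarrow> (real^2) fuzzy set \<Rightarrow>
     ((real^2) fuzzy \<Rightarrow> (real^2) fuzzy \<Rightarrow> real \<Rightarrow> real fuzzy) \<Rightarrow> (real \<Rightarrow> real \<Rightarrow> real) \<Rightarrow> bool" where
  "fuzzy_metric_space eqp eqd le X M star \<longleftrightarrow>
     (\<forall>P\<in>X. fuzzy_point P) \<and> continuous_t_norm star \<and>
     (\<forall>P\<in>X. \<forall>Q\<in>X. \<forall>t>0. fuzzy_set (M P Q t) \<and> (\<forall>r. r \<notin> {0..1} \<longrightarrow> M P Q t r = 0)) \<and>
     (\<forall>P\<in>X. \<forall>Q\<in>X. \<forall>t>0. le (crisp_number 0) (M P Q t) \<and> \<not> eqd (crisp_number 0) (M P Q t)) \<and>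
     (\<forall>P\<in>X. \<forall>Q\<in>X. \<forall>t>0. eqd (M P Q t) (crisp_number 1) \<longleftrightarrow> eqp P Q) \<and>
     (\<forall>P\<in>X. \<forall>Q\<in>X. \<forall>t>0. eqd (M P Q t) (M Q P t)) \<and>
     (\<forall>P\<in>X. \<forall>Q\<in>X. \<forall>S\<in>X. \<forall>t>0. \<forall>s>0.
        le (fuzzy_star star (M P Q t) (M Q S s)) (M P S (t + s))) \<and>
     (\<forall>P\<in>X. \<forall>Q\<in>X. \<forall>\<alpha>\<in>{0..1}.
        continuous_on {0<..} (\<lambda>t. Inf (cut (M P Q t) \<alpha>)) \<and>
        continuous_on {0<..} (\<lambda>t. Sup (cut (M P Q t) \<alpha>)))"

definition KS_bound :: "(real \<Rightarrow> real \<Rightarrow> real) \<Rightarrow> bool" where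
  "KS_bound L \<longleftrightarrow> (\<forall>a\<in>{0..1}. \<forall>b\<in>{0..1}. L a b \<in> {0..1} \<and> L a b = L b a) \<and>
     (\<forall>a\<in>{0..1}. \<forall>b\<in>{0..1}. \<forall>a'\<in>{0..1}. \<forall>b'\<in>{0..1}. a \<le> a' \<longrightarrow> b \<le> b' \<longrightarrow> L a b \<le> L a' b')"

definition KS_fuzzy_metric_space ::
    "'a set \<Rightarrow> ('a \<Rightarrow> 'a \<Rightarrow> real fuzzy) \<Rightarrow> (real \<Rightarrow> real \<Rightarrow> real) \<Rightarrow> (real \<Rightarrow> real \<Rightarrow> real) \<Rightarrow> bool" where
  "KS_fuzzy_metric_space X d L R \<longleftrightarrow>
     KS_bound L \<and> KS_bound R \<and> L 0 0 = 0 \<and> R 1 1 = 1 \<and>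
     (\<forall>x\<in>X. \<forall>y\<in>X. nonneg_fuzzy_number (d x y)) \<and>
     (\<forall>x\<in>X. \<forall>y\<in>X. d x y = crisp_number 0 \<longleftrightarrow> x = y) \<and>
     (\<forall>x\<in>X. \<forall>y\<in>X. d x y = d y x) \<and>
     (let lam = (\<lambda>x y. Inf (cut (d x y) 1)) in
       \<forall>x\<in>X. \<forall>y\<in>X. \<forall>z\<in>X. \<forall>s t.
        (s \<le> lam x z \<longrightarrow> t \<le> lam z y \<longrightarrow> s + t \<le> lam x y \<longrightarrow> d x y (s + t) \<le> R (d x z s) (d z y t)) \<and>
        (s \<ge> lam x z \<longrightarrow> t \<ge> lam z y \<longrightarrow> s + t \<ge> lam x y \<longrightarrow> d x y (s + t) \<ge> L (d x z s) (d z y t)))"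

section \<open>Fuzzy equidistant sets\<close>

definition equidistant_M ::
    "(real^2) fuzzy set \<Rightarrow> (real^2) fuzzy set \<Rightarrow> (real^2) fuzzy set \<Rightarrow> real \<Rightarrow> (real^2) fuzzy set" where
  "equidistant_M X A B t = {x\<in>X. fuzzy_M_set x (fuzzy_union A) t = fuzzy_M_set x (fuzzy_union B) t}"

definition equidistant_d ::
    "(real^2) fuzzy set \<Rightarrow> (real^2) fuzzy set \<Rightarrow> (real^2) fuzzy set \<Rightarrow> (real^2) fuzzy set" where
  "equidistant_d X A B = {x\<in>X. fuzzy_dist_set x (fuzzy_union A) = fuzzy_dist_set x (fuzzy_union B)}"

section \<open>Restrictions to a line are fuzzy numbers along that line\<close>

text \<open>Hence \<open>restrict_to_line\<close> in \<open>fuzzy_dist_set\<close> yields the fuzzy numbers along the joining line.\<close>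

lemma restrict_to_line_fuzzy_number:
  assumes fs: "fuzzy_set \<mu>" and cc: "compact_convex_cuts \<mu>"
    and pa: "p \<noteq> a" and core: "z \<in> affine hull {p, a}" "\<mu> z = 1"
  shows "fuzzy_number_along (affine hull {p, a}) (restrict_to_line \<mu> (affine hull {p, a}))"
proof -
  define e where "e = sgn (a - p)"
  have ne: "norm e = 1" using pa by (simp add: e_def norm_sgn)
  have ea: "norm (a - p) *\<^sub>R e = a - p" using pa by (simp add: e_def sgn_div_norm)
  have line: "affine hull {p, a} = range (\<lambda>s. p + s *\<^sub>R e)" (is "_ = ?l")
  proof -
    have "(\<exists>u. x = p + u *\<^sub>R (a - p)) \<longleftrightarrow> (\<exists>s. x = p + s *\<^sub>R e)" for x
    proof
      assume "\<exists>u. x = p + u *\<^sub>R (a - p)"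
      then show "\<exists>s. x = p + s *\<^sub>R e" using ea by (metis scaleR_scaleR)
    next
      assume "\<exists>s. x = p + s *\<^sub>R e"
      then obtain s where "x = p + s *\<^sub>R e" by blast
      then have "x = p + (s / norm (a - p)) *\<^sub>R (a - p)"
        by (simp add: e_def sgn_div_norm divide_inverse)
      then show "\<exists>u. x = p + u *\<^sub>R (a - p)" by blast
    qed
    then show ?thesis by (auto simp: affine_hull_2_alt)
  qed
  define g where "g s = \<mu> (p + s *\<^sub>R e)" for s
  have g01: "0 \<le> g s" "g s \<le> 1" for s using fs by (auto simp: g_def fuzzy_set_def)
  have closed: "closed {s. r \<le> g s}" for r
  proof -
    consider "r \<le> 0" | "0 < r" "r \<le> 1" | "1 < r" by linarith
    then show ?thesis
    proof cases
      case 1 then have "{s. r \<le> g s} = UNIV" by (auto intro: order_trans[OF _ g01(1)])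
      then show ?thesis by simp
    next
      case 2
      then have "compact (cut \<mu> r)" using cc by (auto simp: compact_convex_cuts_def)
      then have "closed {x. r \<le> \<mu> x}" using 2 by (simp add: cut_def compact_imp_closed)
      moreover have "{s. r \<le> g s} = (\<lambda>s. p + s *\<^sub>R e) -` {x. r \<le> \<mu> x}" by (auto simp: g_def)
      moreover have "continuous_on UNIV (\<lambda>s. p + s *\<^sub>R e)" by (intro continuous_intros)
      ultimately show ?thesis by (simp only: closed_vimage)
    next
      case 3 then have "{s. r \<le> g s} = {}" using g01(2) by (smt (verit) empty_Collect_eq)
      then show ?thesis by simp
    qed
  qed
  have usc: "upper_semicontinuous g"
    unfolding upper_semicontinuous_def
  proof
    fix r
    have "{s. g s < r} = - {s. r \<le> g s}" by auto
    then show "open {s. g s < r}" using closed[of r] by (simp only: open_Compl)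
  qed
  have qc: "r \<le> g s" if "x \<le> s" "s \<le> y" "r \<le> g x" "r \<le> g y" for r s x y
  proof (cases "r \<le> 0")
    case True then show ?thesis using g01(1)[of s] by simp
  next
    case False
    then have r: "0 < r" "r \<le> 1" using that g01(2)[of x] by auto
    then have "convex (cut \<mu> r)" using cc by (auto simp: compact_convex_cuts_def)
    then have cv: "convex {x. r \<le> \<mu> x}" using r by (simp add: cut_def)
    define w where "w = (if x = y then 0 else (s - x) / (y - x))"
    have w: "0 \<le> w" "w \<le> 1" using that by (auto simp: w_def divide_simps)
    have "s = (1 - w) * x + w * y"
    proof (cases "x = y")
      case False
      then have "w * (y - x) = s - x" by (simp add: w_def)
      then show ?thesis by (simp add: algebra_simps)
    qed (use that in \<open>simp add: w_def\<close>)
    then have "p + s *\<^sub>R e = p + ((1 - w) * x + w * y) *\<^sub>R e" by simp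
    then have "p + s *\<^sub>R e = (1 - w) *\<^sub>R (p + x *\<^sub>R e) + w *\<^sub>R (p + y *\<^sub>R e)"
      by (simp add: algebra_simps)
    moreover have "(1 - w) *\<^sub>R (p + x *\<^sub>R e) + w *\<^sub>R (p + y *\<^sub>R e) \<in> {x. r \<le> \<mu> x}"
      by (rule convexD[OF cv]) (use that w in \<open>auto simp: g_def\<close>)
    ultimately show ?thesis by (simp add: g_def)
  qed
  obtain b where b: "g b = 1" using core line by (auto simp: g_def)
  have "bounded (cut \<mu> 0)" using cc by (auto simp: compact_convex_cuts_def compact_imp_bounded)
  then obtain K where K: "norm x \<le> K" if "x \<in> cut \<mu> 0" for x by (auto simp: bounded_iff)
  have zero: "g s = 0" if "\<bar>s\<bar> > K + norm p" for s
  proof (rule ccontr)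
    assume "g s \<noteq> 0"
    then have "\<mu> (p + s *\<^sub>R e) > 0" using g01(1)[of s] by (simp add: g_def)
    then have "p + s *\<^sub>R e \<in> cut \<mu> 0" by (auto simp: cut_def intro: closure_subset[THEN subsetD])
    then have "norm (p + s *\<^sub>R e) \<le> K" using K by blast
    moreover have "norm (s *\<^sub>R e) \<le> norm (p + s *\<^sub>R e) + norm p"
      using norm_triangle_ineq4[of "p + s *\<^sub>R e" p] by simp
    ultimately show False using that ne by simp
  qed
  have "\<bar>b\<bar> \<le> K + norm p" using zero[of b] b by fastforce
  then have "- (K + norm p) \<le> b" "b \<le> K + norm p" by auto
  moreover have "\<forall>x. x \<notin> {- (K + norm p)..K + norm p} \<longrightarrow> g x = 0" using zero by force
  moreover have "mono_on {- (K + norm p)..b} g"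
    using qc[of _ _ b] b g01(2) by (intro mono_onI) auto
  moreover have "antimono_on {b..K + norm p} g"
    using qc[of b] b g01(2) by (intro monotone_onI) auto
  ultimately have "fuzzy_number g"
    unfolding fuzzy_number_def using usc g01 b
    by (intro conjI exI[of _ "- (K + norm p)"] exI[of _ b] exI[of _ "K + norm p"])
       (auto simp: fuzzy_set_def)
  moreover have "(\<lambda>s. restrict_to_line \<mu> ?l (p + s *\<^sub>R e)) = g"
  proof
    fix s
    have "p + s *\<^sub>R e \<in> ?l" by (rule rangeI)
    then show "restrict_to_line \<mu> ?l (p + s *\<^sub>R e) = g s"
      by (simp only: restrict_to_line_def g_def if_True)
  qed
  ultimately show ?thesis
    unfolding fuzzy_number_along_def line using ne
    by (intro conjI exI[of _ p] exI[of _ e]) (auto simp: restrict_to_line_def)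
qed

end

theory Submission
  imports Defs
begin

text \<open>Reading \<open>t / (t + d)\<close> level by level transports the fuzzy set \<open>d\<close> along the map
  \<open>\<delta> \<mapsto> t / (t + \<delta>)\<close>.  A fuzzy set is recovered from its cuts, and this map takes the value
  \<open>t / (t + \<delta>)\<close> only at \<open>\<delta>\<close>, so the degree of closeness at \<open>t / (t + \<delta>)\<close> is the membership of
  \<open>\<delta>\<close> in \<open>d\<close> (\<open>closeness_eq\<close>).  Hence closeness determines \<open>d\<close>, and the proximities of a
  fuzzy point to two fuzzy sets agree exactly when the fuzzy distances do; equidistance therefore
  means the same in both spaces, for every single \<open>t > 0\<close>.

  The argument needs that \<open>d\<close> takes its values in \<open>[0,1]\<close> and that it does not charge \<open>- t\<close>,
  where the denominator vanishes.  For a distance made from inverse points the first is inherited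
  from the membership function of the fuzzy point, and the second holds because Euclidean
  distances are nonnegative.\<close>

text \<open>Since \<open>x\<close> is the only preimage of \<open>f x\<close>, the image levels contain \<open>f x\<close> for the same \<open>\<alpha>\<close>
  for which the cuts contain \<open>x\<close>, and these \<open>\<alpha>\<close> fill the interval up to \<open>\<mu> x\<close>.\<close>

lemma fuzzy_of_levels_image_cut:
  assumes "fuzzy_set \<mu>" and inj: "\<And>y. f y = f x \<Longrightarrow> y = x"
  shows "fuzzy_of_levels (\<lambda>\<alpha>. f ` cut \<mu> \<alpha>) (f x) = \<mu> x"
proof -
  have \<mu>: "0 \<le> \<mu> x" "\<mu> x \<le> 1" using assms(1) by (auto simp: fuzzy_set_def)
  have "f x \<in> f ` cut \<mu> \<alpha> \<longleftrightarrow> x \<in> cut \<mu> \<alpha>" for \<alpha> using inj by (metis image_iff)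
  \<comment> \<open>The 0-cut is a closure and may omit or contain a point of membership 0; the inserted 0
    makes the set come out the same in both cases.\<close>
  then have "insert 0 {\<alpha>\<in>{0..1}. f x \<in> f ` cut \<mu> \<alpha>} = {0..\<mu> x}"
    using \<mu> by (auto simp: cut_def split: if_splits)
  then show ?thesis using \<mu> by (simp add: fuzzy_of_levels_def)
qed

lemma closeness_eq:
  assumes "t > 0" "fuzzy_set d" "\<delta> \<noteq> - t"
  shows "closeness t d (t / (t + \<delta>)) = d \<delta>"
  unfolding closeness_def
proof (rule fuzzy_of_levels_image_cut[where f = "\<lambda>\<delta>. t / (t + \<delta>)", OF assms(2)])
  fix y assume eq: "t / (t + y) = t / (t + \<delta>)"
  have "t / (t + \<delta>) \<noteq> 0" using assms by auto
  \<comment> \<open>Division by zero yields 0, so \<open>y = - t\<close> does not share this value.\<close>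
  with eq have "t + y \<noteq> 0" by auto
  with eq assms show "y = \<delta>" by (simp add: frac_eq_eq)
qed

lemma closeness_inject:
  assumes "t > 0" "fuzzy_set d" "fuzzy_set d'"
    and neg: "\<And>\<delta>. \<delta> < 0 \<Longrightarrow> d \<delta> = 0" "\<And>\<delta>. \<delta> < 0 \<Longrightarrow> d' \<delta> = 0"
  shows "closeness t d = closeness t d' \<longleftrightarrow> d = d'"
proof
  assume eq: "closeness t d = closeness t d'"
  show "d = d'"
  proof
    fix \<delta>
    show "d \<delta> = d' \<delta>"
    proof (cases "\<delta> = - t")
      case True
      then show ?thesis using neg[of \<delta>] assms(1) by simp
    next
      case False
      then show ?thesis using closeness_eq eq assms(1-3) by metis
    qed
  qed
qed simp

lemma fuzzy_set_inverse_distance: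
  assumes "fuzzy_set P"
  shows "fuzzy_set (inverse_distance P p Q q)"
  unfolding fuzzy_set_def
proof
  fix \<delta>
  let ?S = "insert 0 {\<alpha>. \<exists>u v. \<delta> = dist u v \<and> inverse_points P p Q q u v \<and> P u = \<alpha> \<and> Q v = \<alpha>}"
  have S: "?S \<subseteq> {0..1}" using assms by (auto simp: fuzzy_set_def)
  then have "bdd_above ?S" by (meson bdd_above_Icc bdd_above_mono)
  then have "0 \<le> Sup ?S" by (intro cSup_upper) auto
  moreover have "Sup ?S \<le> 1" by (rule cSup_least) (use S in \<open>blast, meson atLeastAtMost_iff subsetD\<close>)
  ultimately show "0 \<le> inverse_distance P p Q q \<delta> \<and> inverse_distance P p Q q \<delta> \<le> 1"
    by (simp add: inverse_distance_def)
qed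

lemma inverse_distance_neg:
  assumes "\<delta> < 0"
  shows "inverse_distance P p Q q \<delta> = 0"
proof -
  have "\<delta> \<noteq> dist u v" for u v :: "real^2" using assms zero_le_dist[of u v] by linarith
  then show ?thesis by (simp add: inverse_distance_def)
qed

lemma fuzzy_set_fuzzy_dist_set:
  assumes "fuzzy_set P"
  shows "fuzzy_set (fuzzy_dist_set P \<mu>)"
proof -
  have "fuzzy_set (restrict_to_line P l)" for l
    using assms by (simp add: fuzzy_set_def restrict_to_line_def)
  then show ?thesis by (simp add: fuzzy_dist_set_def Let_def fuzzy_set_inverse_distance)
qed

lemma fuzzy_dist_set_neg: "\<delta> < 0 \<Longrightarrow> fuzzy_dist_set P \<mu> \<delta> = 0"
  by (simp add: fuzzy_dist_set_def Let_def inverse_distance_neg)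

lemma fuzzy_M_set_eq_iff:
  assumes "fuzzy_set P" "t > 0"
  shows "fuzzy_M_set P \<mu> t = fuzzy_M_set P \<nu> t \<longleftrightarrow> fuzzy_dist_set P \<mu> = fuzzy_dist_set P \<nu>"
  unfolding fuzzy_M_set_def using assms
  by (intro closeness_inject fuzzy_set_fuzzy_dist_set fuzzy_dist_set_neg)

theorem mainTheorem2:
  fixes X A B :: "(real^2) fuzzy set"
    and eqp :: "(real^2) fuzzy \<Rightarrow> (real^2) fuzzy \<Rightarrow> bool"
    and eqd le :: "real fuzzy \<Rightarrow> real fuzzy \<Rightarrow> bool"
    and star L R :: "real \<Rightarrow> real \<Rightarrow> real"
    and t :: real
  assumes "\<forall>P\<in>X. fuzzy_point P"
    and "fuzzy_metric_space eqp eqd le X fuzzy_M star"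
    and "KS_fuzzy_metric_space X fuzzy_dist L R"
    and "A \<subseteq> X" and "A \<noteq> {}" and "compact_convex_cuts (fuzzy_union A)"
    and "B \<subseteq> X" and "B \<noteq> {}" and "compact_convex_cuts (fuzzy_union B)"
    and "t > 0"
  shows "equidistant_M X A B t = equidistant_d X A B"
proof -
  have "fuzzy_set x" if "x \<in> X" for x
    using assms(1) that by (auto simp: fuzzy_point_def fuzzy_point_at_def)
  then show ?thesis
    using \<open>t > 0\<close> by (auto simp: equidistant_M_def equidistant_d_def fuzzy_M_set_eq_iff)
qed

end
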